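(* Let $(\mathcal{A},\bullet)$ be a left-symmetric $\mathrm{L}$-algebra over $\mathbb{K}$, and let $\star:\mathcal{A}\times\mathcal{A}\to\mathcal{A}$ be a bilinear map satisfying, for all $u,v,w\in\mathcal{A}$: (a) $u\star v=-v\star u$; (b) $u\star(v\star w)=u\bullet(v\star w)$; (c) $(u\bullet v)\star w=v\star(u\bullet w)$. Then the vector space $T^*(\mathcal{A})=\mathcal{A}\oplus\mathcal{A}^*$ endowed with the product $$(u+f)\diamond(v+g)=u\bullet v-(\mathrm{L}^\bullet_u)^*(g)+(\mathrm{R}^\star_v)^*(f),\qquad u,v\in\mathcal{A},\ f,g\in\mathcal{A}^*,$$ is a left-symmetric $\mathrm{L}$-algebra. Moreover, the bilinear form $\omega_c:T^*(\mathcal{A})\times T^*(\mathcal{A})\to\mathbb{K}$, $\omega_c(u+f,v+g)=f(v)-g(u)$, is nondegenerate and skew-symmetric, and the left multiplication operators of $\diamond$ are symmetric with respect to $\omega_c$; consequently $(T^*(\mathcal{A}),\diamond,\omega_c)$ is a pre-symplectic left-symmetric algebra. In this case $$\omega_c\big((u+f)\diamond(v+g),w+h\big)=\omega_c\big(u+f,(v+g)\triangleright(w+h)\big)$$ for all $u,v,w\in\mathcal{A}$, $f,g,h\in\mathcal{A}^*$, where $(v+g)\triangleright(w+h)=v\star w-g\circ\mathrm{R}^\bullet_w+h\circ\mathrm{R}^\bullet_v$.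
   Context: $\mathbb{K}$ is a field of characteristic $0$; all vector spaces are finite-dimensional. For a bilinear product $\cdot$ on $\mathcal{A}$: $\mathrm{L}^{\cdot}_u(v)=u\cdot v$, $\mathrm{R}^{\cdot}_u(v)=v\cdot u$. For an endomorphism $\varphi$ of $\mathcal{A}$ depending on $u$ (such as $\mathrm{L}_u^\bullet$, $\mathrm{R}_u^\star$), $\varphi^*\in\mathrm{End}(\mathcal{A}^* )$ denotes the dual with a minus sign: $\varphi^*(f)=-f\circ\varphi$ for $f\in\mathcal{A}^*$. With $(u,v,w)=(u\bullet v)\bullet w-u\bullet(v\bullet w)$, an algebra is left-symmetric if $(u,v,w)=(v,u,w)$; it is an $\mathrm{L}$-algebra if $u\bullet(v\bullet w)=v\bullet(u\bullet w)$; a left-symmetric $\mathrm{L}$-algebra is both. A pre-symplectic left-symmetric algebra is a triple $(\mathcal{B},\cdot,\omega)$ with $(\mathcal{B},\cdot)$ left-symmetric and $\omega$ a nondegenerate skew-symmetric bilinear form such that $\omega(u\cdot v,w)=\omega(v,u\cdot w)$ for all $u,v,w$ (i.e. left multiplications are symmetric with respect to $\omega$). *)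

theory Defs
  imports Complex_Main "HOL-Library.Product_Plus" "HOL-Library.Function_Algebras"
begin

(* The cotangent space is not a type of its own, because the dual space depends on the scalar
   multiplication. Hence all structures live on a carrier V that is a finite-dimensional subspace
   of an ambient vector space; V = UNIV gives a vector space that is a whole type. *)

locale fd_space = vector_space scale
  for scale :: "'k::field_char_0 \<Rightarrow> 'v::ab_group_add \<Rightarrow> 'v" +
  fixes V :: "'v set"
  assumes subspace_carrier: "subspace V"
    and finite_dimensional: "\<exists>B. finite B \<and> span B = V"

definition bilinear_on ::
  "('k::field \<Rightarrow> 'v::ab_group_add \<Rightarrow> 'v) \<Rightarrow> 'v set \<Rightarrow>
   ('k \<Rightarrow> 'w::ab_group_add \<Rightarrow> 'w) \<Rightarrow> 'w set \<Rightarrow> ('v \<Rightarrow> 'v \<Rightarrow> 'w) \<Rightarrow> bool"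
  where "bilinear_on s V t W b \<longleftrightarrow>
    (\<forall>x\<in>V. \<forall>y\<in>V. b x y \<in> W) \<and>
    (\<forall>x\<in>V. \<forall>y\<in>V. \<forall>z\<in>V. b (x + y) z = b x z + b y z) \<and>
    (\<forall>x\<in>V. \<forall>y\<in>V. \<forall>z\<in>V. b x (y + z) = b x y + b x z) \<and>
    (\<forall>c. \<forall>x\<in>V. \<forall>y\<in>V. b (s c x) y = t c (b x y)) \<and>
    (\<forall>c. \<forall>x\<in>V. \<forall>y\<in>V. b x (s c y) = t c (b x y))"

definition left_mult :: "('v \<Rightarrow> 'v \<Rightarrow> 'v) \<Rightarrow> 'v \<Rightarrow> 'v \<Rightarrow> 'v"
  where "left_mult m u = (\<lambda>v. m u v)"

definition right_mult :: "('v \<Rightarrow> 'v \<Rightarrow> 'v) \<Rightarrow> 'v \<Rightarrow> 'v \<Rightarrow> 'v"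
  where "right_mult m u = (\<lambda>v. m v u)"

definition associator :: "('v::ab_group_add \<Rightarrow> 'v \<Rightarrow> 'v) \<Rightarrow> 'v \<Rightarrow> 'v \<Rightarrow> 'v \<Rightarrow> 'v"
  where "associator m u v w = m (m u v) w - m u (m v w)"

locale fd_algebra = fd_space scale V
  for scale :: "'k::field_char_0 \<Rightarrow> 'v::ab_group_add \<Rightarrow> 'v" and V :: "'v set" +
  fixes mult :: "'v \<Rightarrow> 'v \<Rightarrow> 'v"
  assumes bilinear_mult: "bilinear_on scale V scale V mult"

locale left_symmetric_algebra = fd_algebra +
  assumes left_symmetric:
    "\<forall>u\<in>V. \<forall>v\<in>V. \<forall>w\<in>V. associator mult u v w = associator mult v u w"

locale L_algebra = fd_algebra +
  assumes L_identity: "\<forall>u\<in>V. \<forall>v\<in>V. \<forall>w\<in>V. mult u (mult v w) = mult v (mult u w)"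

locale left_symmetric_L_algebra = left_symmetric_algebra + L_algebra

definition nondegenerate_on :: "'v set \<Rightarrow> ('v::zero \<Rightarrow> 'v \<Rightarrow> 'k::zero) \<Rightarrow> bool"
  where "nondegenerate_on V \<omega> \<longleftrightarrow>
    (\<forall>x\<in>V. (\<forall>y\<in>V. \<omega> x y = 0) \<longrightarrow> x = 0) \<and>
    (\<forall>y\<in>V. (\<forall>x\<in>V. \<omega> x y = 0) \<longrightarrow> y = 0)"

definition skew_symmetric_on :: "'v set \<Rightarrow> ('v \<Rightarrow> 'v \<Rightarrow> 'k::uminus) \<Rightarrow> bool"
  where "skew_symmetric_on V \<omega> \<longleftrightarrow> (\<forall>x\<in>V. \<forall>y\<in>V. \<omega> x y = - \<omega> y x)"

definition symmetric_wrt_on :: "'v set \<Rightarrow> ('v \<Rightarrow> 'v \<Rightarrow> 'k) \<Rightarrow> ('v \<Rightarrow> 'v) \<Rightarrow> bool"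
  where "symmetric_wrt_on V \<omega> \<phi> \<longleftrightarrow> (\<forall>x\<in>V. \<forall>y\<in>V. \<omega> (\<phi> x) y = \<omega> x (\<phi> y))"

locale presymplectic_left_symmetric_algebra = left_symmetric_algebra scale V mult
  for scale :: "'k::field_char_0 \<Rightarrow> 'v::ab_group_add \<Rightarrow> 'v" and V :: "'v set"
    and mult :: "'v \<Rightarrow> 'v \<Rightarrow> 'v" +
  fixes \<omega> :: "'v \<Rightarrow> 'v \<Rightarrow> 'k"
  assumes bilinear_form: "bilinear_on scale V (*) UNIV \<omega>"
    and nondegenerate: "nondegenerate_on V \<omega>"
    and skew_symmetric: "skew_symmetric_on V \<omega>"
    and left_mult_symmetric: "\<forall>u\<in>V. symmetric_wrt_on V \<omega> (left_mult mult u)"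

definition dual_space :: "('k::field \<Rightarrow> 'v::ab_group_add \<Rightarrow> 'v) \<Rightarrow> ('v \<Rightarrow> 'k) set"
  where "dual_space s = {f. Vector_Spaces.linear s (*) f}"

(* The dual of an endomorphism carries a minus sign. *)
definition dual_map :: "('v \<Rightarrow> 'v) \<Rightarrow> ('v \<Rightarrow> 'k::ab_group_add) \<Rightarrow> 'v \<Rightarrow> 'k"
  where "dual_map \<phi> f = - (f \<circ> \<phi>)"

(* The element u + f of the cotangent space is the pair (u, f). *)
definition cotangent_space ::
  "('k::field \<Rightarrow> 'v::ab_group_add \<Rightarrow> 'v) \<Rightarrow> ('v \<times> ('v \<Rightarrow> 'k)) set"
  where "cotangent_space s = UNIV \<times> dual_space s"

definition cotangent_scale ::
  "('k::field \<Rightarrow> 'v \<Rightarrow> 'v) \<Rightarrow> 'k \<Rightarrow> 'v \<times> ('v \<Rightarrow> 'k) \<Rightarrow> 'v \<times> ('v \<Rightarrow> 'k)"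
  where "cotangent_scale s c = (\<lambda>(u, f). (s c u, \<lambda>x. c * f x))"

definition cotangent_mult ::
  "('v \<Rightarrow> 'v \<Rightarrow> 'v) \<Rightarrow> ('v \<Rightarrow> 'v \<Rightarrow> 'v) \<Rightarrow>
   'v \<times> ('v \<Rightarrow> 'k::ab_group_add) \<Rightarrow> 'v \<times> ('v \<Rightarrow> 'k) \<Rightarrow> 'v \<times> ('v \<Rightarrow> 'k)"
  where "cotangent_mult bul star = (\<lambda>(u, f) (v, g).
    (bul u v, - dual_map (left_mult bul u) g + dual_map (right_mult star v) f))"

definition cotangent_form ::
  "'v \<times> ('v \<Rightarrow> 'k::ab_group_add) \<Rightarrow> 'v \<times> ('v \<Rightarrow> 'k) \<Rightarrow> 'k"
  where "cotangent_form = (\<lambda>(u, f) (v, g). f v - g u)"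

definition cotangent_triangle ::
  "('v \<Rightarrow> 'v \<Rightarrow> 'v) \<Rightarrow> ('v \<Rightarrow> 'v \<Rightarrow> 'v) \<Rightarrow>
   'v \<times> ('v \<Rightarrow> 'k::ab_group_add) \<Rightarrow> 'v \<times> ('v \<Rightarrow> 'k) \<Rightarrow> 'v \<times> ('v \<Rightarrow> 'k)"
  where "cotangent_triangle bul star = (\<lambda>(v, g) (w, h).
    (star v w, - (g \<circ> right_mult bul w) + (h \<circ> right_mult bul v)))"

end

theory Submission
  imports Defs
begin

text \<open>
  Write \<open>X = (u, f)\<close>, \<open>Y = (v, g)\<close>, \<open>Z = (w, h)\<close>. The product unfolds to
  \<open>X \<diamond> Y = (u \<bullet> v, x \<mapsto> g (u \<bullet> x) - f (x \<star> v))\<close>, so every identity in the cotangent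
  space splits into the same identity in the base algebra and an identity between functionals,
  which is compared coefficient by coefficient in \<open>f\<close>, \<open>g\<close>, \<open>h\<close>.

  Given the L-identity, left-symmetry is the same as symmetry of \<open>(X \<diamond> Y) \<diamond> Z\<close> in \<open>X\<close> and \<open>Y\<close>,
  so two computations suffice. The dual part of \<open>X \<diamond> (Y \<diamond> Z)\<close> at \<open>x\<close> is
  \<open>h (v \<bullet> (u \<bullet> x)) - g ((u \<bullet> x) \<star> w) - f (x \<star> (v \<bullet> w))\<close>: the \<open>h\<close> term is symmetric by the
  L-identity of the base, and the other two are exchanged by
  \<open>(u \<bullet> x) \<star> w = x \<star> (u \<bullet> w)\<close>.
  The dual part of \<open>(X \<diamond> Y) \<diamond> Z\<close> at \<open>x\<close> is
  \<open>h ((u \<bullet> v) \<bullet> x) - g (u \<bullet> (x \<star> w)) + f ((x \<star> w) \<star> v)\<close>, and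
  \<open>(x \<star> w) \<star> v = - v \<star> (x \<star> w) = - v \<bullet> (x \<star> w)\<close> turns the last term into \<open>- f (v \<bullet> (x \<star> w))\<close>, the mirror image of the middle one.

  The two adjunction formulas for the form \<open>\<omega> (u, f) (v, g) = f v - g u\<close> come from the skew-symmetry
  of \<open>\<star>\<close>: all of \<open>\<omega> (X \<diamond> Y) Z\<close>, \<open>\<omega> Y (X \<diamond> Z)\<close> and \<open>\<omega> X (Y \<triangleright> Z)\<close> evaluate to
  \<open>g (u \<bullet> w) - h (u \<bullet> v) + f (v \<star> w)\<close>. Nondegeneracy and finite-dimensionality of the cotangent
  space both come from the coordinate functionals of a basis, which separate points and span
  the dual space.
\<close>

section \<open>The dual space and the cotangent space\<close>

lemma mem_dual_space_iff:
  fixes scale :: "'k::field \<Rightarrow> 'a::ab_group_add \<Rightarrow> 'a"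
  assumes "vector_space scale"
  shows "f \<in> dual_space scale \<longleftrightarrow>
    (\<forall>x y. f (x + y) = f x + f y) \<and> (\<forall>c x. f (scale c x) = c * f x)"
proof -
  have "vector_space ((*) :: 'k \<Rightarrow> 'k \<Rightarrow> 'k)"
    by unfold_locales (auto simp: algebra_simps)
  with assms show ?thesis
    by (simp add: dual_space_def Vector_Spaces.linear_iff)
qed

lemma dual_space_diff:
  assumes "vector_space scale" "f \<in> dual_space scale"
  shows "f (x - y) = f x - f y"
  using assms by (metis add_diff_cancel diff_add_cancel mem_dual_space_iff)

lemma dual_space_zero:
  assumes "vector_space scale" "f \<in> dual_space scale"
  shows "f 0 = 0"
  using dual_space_diff[OF assms, of 0 0] by simp

lemma dual_space_minus:
  assumes "vector_space scale" "f \<in> dual_space scale"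
  shows "f (- x) = - f x"
  using dual_space_diff[OF assms, of 0 x] dual_space_zero[OF assms] by simp

lemma dual_space_sum:
  assumes "vector_space scale" "f \<in> dual_space scale"
  shows "f (sum x A) = (\<Sum>a\<in>A. f (x a))"
  by (induction A rule: infinite_finite_induct)
    (use assms in \<open>auto simp: dual_space_zero mem_dual_space_iff\<close>)

lemma vector_space_cotangent_scale:
  assumes "vector_space scale"
  shows "vector_space (cotangent_scale scale)"
proof -
  interpret vector_space scale by fact
  show ?thesis
    by unfold_locales
      (auto simp: cotangent_scale_def fun_eq_iff algebra_simps scale_right_distrib scale_left_distrib)
qed

lemma sum_fun_apply: "sum F A x = (\<Sum>a\<in>A. F a x)"
  by (induction A rule: infinite_finite_induct) auto

text \<open>
  With a finite basis \<open>B\<close> of the base, the vectors \<open>(b, 0)\<close> and \<open>(0, b*)\<close>, where \<open>b*\<close> is the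
  coordinate functional of \<open>b\<close>, span the cotangent space, because \<open>f = (\<Sum>b\<in>B. f b * b*)\<close>.
\<close>

lemma fd_space_cotangent_space:
  fixes scale :: "'k::field_char_0 \<Rightarrow> 'a::ab_group_add \<Rightarrow> 'a"
  assumes "fd_space scale UNIV"
  shows "fd_space (cotangent_scale scale) (cotangent_space scale)"
proof -
  interpret fd_space scale UNIV by fact
  have vs: "vector_space scale" by unfold_locales
  interpret C: vector_space "cotangent_scale scale"
    by (rule vector_space_cotangent_scale[OF vs])
  note dual_iff = mem_dual_space_iff[OF vs]
  have sub: "C.subspace (cotangent_space scale)"
    by (rule C.subspaceI)
      (auto simp: cotangent_space_def cotangent_scale_def dual_iff zero_prod_def algebra_simps)
  obtain B where B: "finite B" "independent B" "span B = UNIV"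
    using finite_dimensional by (metis basis_exists finite_subset span_mono span_span top.extremum_uniqueI)
  define D where "D = (\<lambda>b. (b, 0 :: 'a \<Rightarrow> 'k)) ` B \<union> (\<lambda>b. (0, \<lambda>v. representation B v b)) ` B"
  have "D \<subseteq> cotangent_space scale"
    using B by (auto simp: D_def cotangent_space_def dual_iff representation_add representation_scale)
  then have "C.span D \<subseteq> cotangent_space scale"
    using sub by (rule C.span_minimal)
  moreover have "(u, f) \<in> C.span D" if f: "f \<in> dual_space scale" for u f
  proof -
    have expand: "(\<Sum>b\<in>B. scale (representation B v b) b) = v" for v
      using B by (intro sum_representation_eq) auto
    have f_apply: "f v = (\<Sum>b\<in>B. f b * representation B v b)" for v
    proof -
      have "f v = f (\<Sum>b\<in>B. scale (representation B v b) b)"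
        by (simp only: expand)
      also have "\<dots> = (\<Sum>b\<in>B. f b * representation B v b)"
        using f by (simp add: dual_space_sum[OF vs f] dual_iff mult.commute)
      finally show ?thesis .
    qed
    have f_eq: "(\<Sum>b\<in>B. (\<lambda>v. f b * representation B v b)) = f"
      by (rule ext) (simp only: sum_fun_apply flip: f_apply)
    have pair_sum: "(\<Sum>b\<in>B. (p b, q b)) = (sum p B, sum q B)"
      for p :: "'a \<Rightarrow> 'a" and q :: "'a \<Rightarrow> 'a \<Rightarrow> 'k"
      by (simp add: prod_eq_iff fst_sum snd_sum)
    have "(u, f) = (\<Sum>b\<in>B. cotangent_scale scale (representation B u b) (b, 0))
        + (\<Sum>b\<in>B. cotangent_scale scale (f b) (0, \<lambda>v. representation B v b))"
      by (simp add: cotangent_scale_def pair_sum expand f_eq flip: zero_fun_def)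
    moreover have "\<dots> \<in> C.span D"
      by (intro C.span_add C.span_sum C.span_scale C.span_base) (auto simp: D_def)
    ultimately show ?thesis by simp
  qed
  ultimately have "C.span D = cotangent_space scale"
    by (auto simp: cotangent_space_def)
  moreover have "finite D"
    using B by (simp add: D_def)
  ultimately show ?thesis
    using sub by unfold_locales auto
qed

text \<open>The coordinates of \<open>u\<close> in a basis are values of functionals, so they all vanish.\<close>

lemma dual_space_separates_points:
  fixes scale :: "'k::field \<Rightarrow> 'a::ab_group_add \<Rightarrow> 'a"
  assumes "vector_space scale" and "\<And>f. f \<in> dual_space scale \<Longrightarrow> f u = 0"
  shows "u = 0"
proof -
  interpret vector_space scale by fact
  obtain B where B: "independent B" "span B = UNIV"
    using basis_exists[of UNIV] by (metis top.extremum_uniqueI)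
  have "(\<lambda>v. representation B v b) \<in> dual_space scale" for b
    using B by (simp add: mem_dual_space_iff[OF assms(1)] representation_add representation_scale)
  then have "representation B u b = 0" for b
    using assms(2) by blast
  then show ?thesis
    using sum_nonzero_representation_eq[of B u] B by simp
qed

section \<open>The canonical form\<close>

text \<open>
  If \<open>(u, f)\<close> pairs to zero with everything, the vectors \<open>(v, 0)\<close> give \<open>f = 0\<close>, and then the vectors
  \<open>(0, g)\<close> show that every functional vanishes at \<open>u\<close>.
\<close>

lemma nondegenerate_cotangent_form:
  fixes scale :: "'k::field \<Rightarrow> 'a::ab_group_add \<Rightarrow> 'a"
  assumes "vector_space scale"
  shows "nondegenerate_on (cotangent_space scale) cotangent_form"
proof -
  have zero: "0 \<in> dual_space scale"
    by (simp add: mem_dual_space_iff[OF assms])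
  have "u = 0 \<and> f = 0"
    if pair: "\<And>v g. g \<in> dual_space scale \<Longrightarrow> f v = g u" for u :: 'a and f :: "'a \<Rightarrow> 'k"
  proof
    show "f = 0"
      using pair[OF zero] by (simp add: fun_eq_iff)
    with pair have "g u = 0" if "g \<in> dual_space scale" for g
      using that by (metis zero_fun_apply)
    then show "u = 0"
      by (rule dual_space_separates_points[OF assms])
  qed
  then show ?thesis
    unfolding nondegenerate_on_def cotangent_space_def cotangent_form_def
    by (auto simp: zero_prod_def) metis+
qed

lemma skew_symmetric_cotangent_form:
  fixes scale :: "'k::field \<Rightarrow> 'a::ab_group_add \<Rightarrow> 'a"
  shows "skew_symmetric_on (cotangent_space scale) cotangent_form"
  by (auto simp: skew_symmetric_on_def cotangent_form_def)

lemma bilinear_cotangent_form: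
  assumes "vector_space scale"
  shows "bilinear_on (cotangent_scale scale) (cotangent_space scale) (*) UNIV cotangent_form"
  by (auto simp: bilinear_on_def cotangent_space_def cotangent_form_def cotangent_scale_def
      mem_dual_space_iff[OF assms] algebra_simps)

section \<open>The cotangent product\<close>

lemma cotangent_mult_apply:
  "cotangent_mult bul star (u, f) (v, g) = (bul u v, \<lambda>x. g (bul u x) - f (star x v))"
  by (simp add: cotangent_mult_def dual_map_def left_mult_def right_mult_def fun_eq_iff)

lemma bilinear_cotangent_mult:
  assumes "vector_space scale"
    and "bilinear_on scale UNIV scale UNIV bul" "bilinear_on scale UNIV scale UNIV star"
  shows "bilinear_on (cotangent_scale scale) (cotangent_space scale)
    (cotangent_scale scale) (cotangent_space scale) (cotangent_mult bul star)"
  using assms(2,3)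
  by (auto simp: bilinear_on_def cotangent_space_def cotangent_scale_def cotangent_mult_apply
      mem_dual_space_iff[OF assms(1)] fun_eq_iff algebra_simps)

text \<open>
  Once the L-identity is known, the terms \<open>X \<diamond> (Y \<diamond> Z)\<close> and \<open>Y \<diamond> (X \<diamond> Z)\<close> of the associators agree, and
  left-symmetry reduces to \<open>(X \<diamond> Y) \<diamond> Z = (Y \<diamond> X) \<diamond> Z\<close>. This reduction is applied twice: downwards in the
  base (\<open>swap\<close>) and upwards in the cotangent space (\<open>swap_cot\<close>).
\<close>

lemma left_symmetric_L_algebra_cotangent:
  fixes scale :: "'k::field_char_0 \<Rightarrow> 'a::ab_group_add \<Rightarrow> 'a"
    and bul :: "'a \<Rightarrow> 'a \<Rightarrow> 'a" (infixl "\<bullet>" 70)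
    and star :: "'a \<Rightarrow> 'a \<Rightarrow> 'a" (infixl "\<star>" 70)
  assumes "left_symmetric_L_algebra scale UNIV (\<bullet>)"
    and star: "bilinear_on scale UNIV scale UNIV (\<star>)"
    and skew: "\<And>u v. u \<star> v = - (v \<star> u)"
    and star_star: "\<And>u v w. u \<star> (v \<star> w) = u \<bullet> (v \<star> w)"
    and bul_star: "\<And>u v w. (u \<bullet> v) \<star> w = v \<star> (u \<bullet> w)"
  shows "left_symmetric_L_algebra
    (cotangent_scale scale) (cotangent_space scale) (cotangent_mult (\<bullet>) (\<star>))"
proof -
  interpret A: left_symmetric_L_algebra scale UNIV "(\<bullet>)" by fact
  have vs: "vector_space scale" by unfold_locales
  interpret C: fd_space "cotangent_scale scale" "cotangent_space scale"
    by (rule fd_space_cotangent_space) unfold_locales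
  have L: "u \<bullet> (v \<bullet> w) = v \<bullet> (u \<bullet> w)" for u v w
    using A.L_identity by blast
  have swap: "(u \<bullet> v) \<bullet> w = (v \<bullet> u) \<bullet> w" for u v w
  proof -
    have "associator (\<bullet>) u v w = associator (\<bullet>) v u w"
      using A.left_symmetric by blast
    then show ?thesis
      using L[of u v w] by (simp add: associator_def)
  qed
  have star_bul: "(x \<star> w) \<star> v = - (v \<bullet> (x \<star> w))" for x v w
    using skew[of "x \<star> w" v] star_star[of v x w] by simp
  let ?m = "cotangent_mult (\<bullet>) (\<star>)"
  have L_cot: "?m X (?m Y Z) = ?m Y (?m X Z)" for X Y Z :: "'a \<times> ('a \<Rightarrow> 'k)"
    by (cases X; cases Y; cases Z) (simp add: cotangent_mult_apply L bul_star fun_eq_iff)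
  \<comment> \<open>The arguments must lie in the carrier, since the signs from \<open>star_bul\<close> are pulled out of the
    functionals by linearity.\<close>
  have swap_cot: "?m (?m X Y) Z = ?m (?m Y X) Z"
    if "X \<in> cotangent_space scale" "Y \<in> cotangent_space scale" for X Y Z
    using that
    by (cases X; cases Y; cases Z)
      (auto simp: cotangent_mult_apply cotangent_space_def fun_eq_iff swap
        dual_space_minus[OF vs] star_bul)
  show ?thesis
    by unfold_locales
      (auto simp: associator_def L_cot intro: swap_cot
        bilinear_cotangent_mult[OF vs A.bilinear_mult star])
qed

text \<open>
  The two sides contain the functional \<open>f\<close> of the multiplying element as \<open>- f (w \<star> v)\<close> and \<open>f (v \<star> w)\<close>;
  everything else matches literally. The same discrepancy occurs for the right adjoint below.
\<close>

lemma cotangent_left_mult_symmetric: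
  assumes "vector_space scale" and "\<And>u v. star u v = - star v u"
  shows "\<forall>x\<in>cotangent_space scale. symmetric_wrt_on (cotangent_space scale) cotangent_form
    (left_mult (cotangent_mult bul star) x)"
proof -
  have "f (star v w) = - f (star w v)" if "f \<in> dual_space scale" for f v w
    using assms(2)[of v w] dual_space_minus[OF assms(1) that] by metis
  then show ?thesis
    by (fastforce simp: symmetric_wrt_on_def cotangent_space_def cotangent_form_def left_mult_def
        cotangent_mult_apply)
qed

lemma cotangent_triangle_mem:
  assumes "vector_space scale" and "bilinear_on scale UNIV scale UNIV bul"
    and "g \<in> dual_space scale" "h \<in> dual_space scale"
  shows "cotangent_triangle bul star (v, g) (w, h) \<in> cotangent_space scale"
  using assms(2-)
  by (auto simp: cotangent_triangle_def cotangent_space_def right_mult_def bilinear_on_def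
      mem_dual_space_iff[OF assms(1)] algebra_simps)

lemma cotangent_triangle_adjoint:
  assumes "vector_space scale" and "\<And>u v. star u v = - star v u" and "f \<in> dual_space scale"
  shows "cotangent_form (cotangent_mult bul star (u, f) (v, g)) (w, h) =
    cotangent_form (u, f) (cotangent_triangle bul star (v, g) (w, h))"
proof -
  have "f (star v w) = - f (star w v)"
    using assms(2)[of v w] dual_space_minus[OF assms(1,3)] by metis
  then show ?thesis
    by (simp add: cotangent_form_def cotangent_mult_apply cotangent_triangle_def right_mult_def)
qed

section \<open>The cotangent pre-symplectic left-symmetric algebra\<close>

theorem theorem2p15p11:
  fixes scale :: "'k::field_char_0 \<Rightarrow> 'a::ab_group_add \<Rightarrow> 'a"
    and bul :: "'a \<Rightarrow> 'a \<Rightarrow> 'a" (infixl "\<bullet>" 70)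
    and star :: "'a \<Rightarrow> 'a \<Rightarrow> 'a" (infixl "\<star>" 70)
  assumes "left_symmetric_L_algebra scale UNIV (\<bullet>)"
    and "bilinear_on scale UNIV scale UNIV (\<star>)"
    and "\<And>u v. u \<star> v = - (v \<star> u)"
    and "\<And>u v w. u \<star> (v \<star> w) = u \<bullet> (v \<star> w)"
    and "\<And>u v w. (u \<bullet> v) \<star> w = v \<star> (u \<bullet> w)"
  shows "left_symmetric_L_algebra
        (cotangent_scale scale) (cotangent_space scale) (cotangent_mult (\<bullet>) (\<star>)) \<and>
      nondegenerate_on (cotangent_space scale) cotangent_form \<and>
      skew_symmetric_on (cotangent_space scale) cotangent_form \<and>
      (\<forall>x\<in>cotangent_space scale.
        symmetric_wrt_on (cotangent_space scale) cotangent_form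
          (left_mult (cotangent_mult (\<bullet>) (\<star>)) x)) \<and>
      presymplectic_left_symmetric_algebra
        (cotangent_scale scale) (cotangent_space scale) (cotangent_mult (\<bullet>) (\<star>))
        cotangent_form \<and>
      (\<forall>u v w. \<forall>f\<in>dual_space scale. \<forall>g\<in>dual_space scale. \<forall>h\<in>dual_space scale.
        cotangent_triangle (\<bullet>) (\<star>) (v, g) (w, h) \<in> cotangent_space scale \<and>
        cotangent_form (cotangent_mult (\<bullet>) (\<star>) (u, f) (v, g)) (w, h) =
        cotangent_form (u, f) (cotangent_triangle (\<bullet>) (\<star>) (v, g) (w, h)))"
proof -
  interpret A: left_symmetric_L_algebra scale UNIV "(\<bullet>)" by fact
  have vs: "vector_space scale" by unfold_locales
  interpret C: left_symmetric_L_algebra "cotangent_scale scale" "cotangent_space scale"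
    "cotangent_mult (\<bullet>) (\<star>)"
    using assms by (rule left_symmetric_L_algebra_cotangent)
  note form = nondegenerate_cotangent_form[OF vs] skew_symmetric_cotangent_form[of scale]
    cotangent_left_mult_symmetric[OF vs assms(3), of "(\<bullet>)"]
  have "presymplectic_left_symmetric_algebra
      (cotangent_scale scale) (cotangent_space scale) (cotangent_mult (\<bullet>) (\<star>)) cotangent_form"
    using form bilinear_cotangent_form[OF vs] by unfold_locales
  with form C.left_symmetric_L_algebra_axioms show ?thesis
    by (auto intro: cotangent_triangle_mem[OF vs A.bilinear_mult]
        cotangent_triangle_adjoint[OF vs assms(3)])
qed

end
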